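(* There exists a constant $c(\infty)>0$ such that for all integers $n\ge 1$, \[c(\infty)\sqrt{n}\le c_{(D,\infty)}(T_n)\le 2n,\] where $T_n$ is the binary tree of depth $n$ and $c_{(D,\infty)}(T_n)$ is the distortion of embeddings of $T_n$ into the sequence $\{D_{m,\infty}\}_{m=1}^\infty$ of diamonds of infinite branching.
   Context: All graphs are identified with their vertex sets endowed with the shortest path distance (the distance between two vertices is the number of edges in a shortest path between them). Binary tree: the binary tree $T_n$ of depth $n$ is the finite graph whose vertices are the finite (possibly empty) sequences of $0$'s and $1$'s of length at most $n$; two vertices are adjacent if the sequence representing one of them is obtained from the sequence representing the other by adding one term on the right. Diamonds of infinite branching: $D_{0,\infty}$ is a graph consisting of two vertices joined by one edge. The graph $D_{m+1,\infty}$ is obtained from $D_{m,\infty}$ by replacing each edge $uv$ of $D_{m,\infty}$ by a countably infinite set of paths of length $2$ joining $u$ and $v$ (the midpoints of these paths are new vertices, all distinct, and distinct for distinct edges). Distortion: let $M$ be a finite metric space and $\{R_m\}_{m=1}^\infty$ a sequence of metric spaces. The distortion of embeddings of $M$ into $\{R_m\}_{m=1}^\infty$ is the infimum of those $C\ge 1$ for which there exist $m\in\mathbb{N}$, a map $f:M\to R_m$, and a number $r>0$ such that \[\forall u,v\in M\quad r\,d_M(u,v)\le d_{R_m}(f(u),f(v))\le rC\,d_M(u,v).\] $c_{(D,\infty)}(M)$ denotes this quantity for $R_m=D_{m,\infty}$. *)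

theory Defs
  imports "HOL-Analysis.Analysis"
begin

text \<open>
  An undirected graph is given by a vertex set \<open>V\<close> and a set \<open>E\<close> of pairs listing every edge
  in some orientation; adjacency is the symmetric closure \<open>E \<union> E\<inverse>\<close>, so that
  \<open>(u, v) \<in> (E \<union> E\<inverse>) ^^ k\<close> says that there is a walk with \<open>k\<close> edges from \<open>u\<close> to \<open>v\<close>.
  A shortest walk is a shortest path.
\<close>

definition graph_dist :: "('a \<times> 'a) set \<Rightarrow> 'a \<Rightarrow> 'a \<Rightarrow> nat" where
  "graph_dist E u v = (LEAST k. (u, v) \<in> (E \<union> E\<inverse>) ^^ k)"

definition connected_graph :: "'a set \<Rightarrow> ('a \<times> 'a) set \<Rightarrow> bool" where
  "connected_graph V E \<longleftrightarrow> (\<forall>u\<in>V. \<forall>v\<in>V. (u, v) \<in> (E \<union> E\<inverse>)\<^sup>*)"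

text \<open>The following is meaningful only for connected graphs, see \<open>Metric_space_graph_dist\<close>.\<close>

definition graph_metric :: "'a set \<Rightarrow> ('a \<times> 'a) set \<Rightarrow> 'a metric" where
  "graph_metric V E = metric (V, \<lambda>u v. real (graph_dist E u v))"

lemma graph_dist_walk:
  assumes "(u, v) \<in> (E \<union> E\<inverse>)\<^sup>*"
  shows "(u, v) \<in> (E \<union> E\<inverse>) ^^ graph_dist E u v"
proof -
  obtain k where "(u, v) \<in> (E \<union> E\<inverse>) ^^ k"
    using assms rtrancl_imp_relpow by blast
  then show ?thesis unfolding graph_dist_def by (rule LeastI)
qed

lemma graph_dist_le: "(u, v) \<in> (E \<union> E\<inverse>) ^^ k \<Longrightarrow> graph_dist E u v \<le> k"
  unfolding graph_dist_def by (rule Least_le)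

lemma relpow_symcl_commute:
  "(u, v) \<in> (E \<union> E\<inverse>) ^^ k \<longleftrightarrow> (v, u) \<in> (E \<union> E\<inverse>) ^^ k"
proof -
  have "(u, v) \<in> (E \<union> E\<inverse>) ^^ k \<Longrightarrow> (v, u) \<in> (E \<union> E\<inverse>) ^^ k" for u v
  proof (induction k arbitrary: v)
    case 0
    then show ?case by simp
  next
    case (Suc k)
    then obtain w where "(u, w) \<in> (E \<union> E\<inverse>) ^^ k" "(w, v) \<in> E \<union> E\<inverse>" by auto
    with Suc.IH show ?case by (intro relpow_Suc_I2[of v w]) auto
  qed
  then show ?thesis by blast
qed

lemma Metric_space_graph_dist:
  assumes "connected_graph V E"
  shows "Metric_space V (\<lambda>u v. real (graph_dist E u v))"
proof
  show "0 \<le> real (graph_dist E u v)" for u v by simp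
  show "real (graph_dist E u v) = real (graph_dist E v u)" for u v
    by (simp add: graph_dist_def relpow_symcl_commute[of u v])
  show "(real (graph_dist E u v) = 0) = (u = v)" if "u \<in> V" "v \<in> V" for u v
    using graph_dist_walk[of u v E] graph_dist_le[of u v 0 E] that assms
    by (auto simp: connected_graph_def)
  show "real (graph_dist E u w) \<le> real (graph_dist E u v) + real (graph_dist E v w)"
    if "u \<in> V" "v \<in> V" "w \<in> V" for u v w
  proof -
    have "(u, v) \<in> (E \<union> E\<inverse>) ^^ graph_dist E u v" "(v, w) \<in> (E \<union> E\<inverse>) ^^ graph_dist E v w"
      using that assms by (auto simp: connected_graph_def intro!: graph_dist_walk)
    then have "(u, w) \<in> (E \<union> E\<inverse>) ^^ (graph_dist E u v + graph_dist E v w)"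
      by (auto simp: relpow_add)
    from graph_dist_le[OF this] show ?thesis by linarith
  qed
qed

lemma
  assumes "connected_graph V E"
  shows mspace_graph_metric: "mspace (graph_metric V E) = V"
    and mdist_graph_metric: "mdist (graph_metric V E) = (\<lambda>u v. real (graph_dist E u v))"
  unfolding graph_metric_def
  using Metric_space.mspace_metric[OF Metric_space_graph_dist[OF assms]]
    Metric_space.mdist_metric[OF Metric_space_graph_dist[OF assms]]
  by auto

definition tree_verts :: "nat \<Rightarrow> bool list set" where
  "tree_verts n = {xs. length xs \<le> n}"

definition tree_edges :: "nat \<Rightarrow> (bool list \<times> bool list) set" where
  "tree_edges n = {(xs, xs @ [b]) | xs b. length xs < n}"

definition binary_tree :: "nat \<Rightarrow> bool list metric" where
  "binary_tree n = graph_metric (tree_verts n) (tree_edges n)"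

lemma connected_tree: "connected_graph (tree_verts n) (tree_edges n)"
proof -
  let ?R = "tree_edges n \<union> (tree_edges n)\<inverse>"
  have root: "length xs \<le> n \<Longrightarrow> ([], xs) \<in> ?R\<^sup>*" for xs
  proof (induction xs rule: rev_induct)
    case (snoc b xs)
    then have "(xs, xs @ [b]) \<in> ?R" by (auto simp: tree_edges_def)
    with snoc show ?case by (auto intro: rtrancl_into_rtrancl)
  qed simp
  have "sym (?R\<^sup>*)" by (intro sym_rtrancl sym_Un_converse)
  with root show ?thesis unfolding connected_graph_def tree_verts_def
    by (blast dest: symD intro: rtrancl_trans)
qed

lemmas mspace_binary_tree = mspace_graph_metric[OF connected_tree, folded binary_tree_def]
lemmas mdist_binary_tree = mdist_graph_metric[OF connected_tree, folded binary_tree_def]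

text \<open>
  \<open>Mid u v i\<close> is the midpoint of the \<open>i\<close>-th path of length 2 replacing the edge \<open>uv\<close>.  Every
  edge is listed in exactly one orientation (\<open>diamond_edges_asym\<close>), so each edge receives its
  midpoints only once, and the midpoints are new (\<open>Mid_fresh\<close>).
\<close>

datatype dvertex = Bot | Top | Mid dvertex dvertex nat

primrec diamond_edges :: "nat \<Rightarrow> (dvertex \<times> dvertex) set" where
  "diamond_edges 0 = {(Bot, Top)}"
| "diamond_edges (Suc m) =
     (\<Union>(u, v) \<in> diamond_edges m. \<Union>i. {(u, Mid u v i), (Mid u v i, v)})"

primrec diamond_verts :: "nat \<Rightarrow> dvertex set" where
  "diamond_verts 0 = {Bot, Top}"
| "diamond_verts (Suc m) = diamond_verts m \<union> {Mid u v i | u v i. (u, v) \<in> diamond_edges m}"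

definition diamond :: "nat \<Rightarrow> dvertex metric" where
  "diamond m = graph_metric (diamond_verts m) (diamond_edges m)"

primrec dlevel :: "dvertex \<Rightarrow> nat" where
  "dlevel Bot = 0"
| "dlevel Top = 0"
| "dlevel (Mid u v i) = Suc (max (dlevel u) (dlevel v))"

lemma dlevel_edge: "(u, v) \<in> diamond_edges m \<Longrightarrow> max (dlevel u) (dlevel v) = m"
  by (induction m arbitrary: u v) fastforce+

lemma dlevel_vert: "v \<in> diamond_verts m \<Longrightarrow> dlevel v \<le> m"
  by (induction m arbitrary: v) (auto dest: dlevel_edge intro: le_SucI)

lemma Mid_fresh: "(u, v) \<in> diamond_edges m \<Longrightarrow> Mid u v i \<notin> diamond_verts m"
  using dlevel_vert[of "Mid u v i" m] dlevel_edge[of u v m] by auto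

lemma diamond_edges_asym: "(u, v) \<in> diamond_edges m \<Longrightarrow> (v, u) \<notin> diamond_edges m"
proof (induction m arbitrary: u v)
  case 0
  then show ?case by simp
next
  case (Suc m)
  have edgeD: "(\<exists>b i. (x, b) \<in> diamond_edges m \<and> y = Mid x b i) \<or>
      (\<exists>a i. (a, y) \<in> diamond_edges m \<and> x = Mid a y i)"
    if "(x, y) \<in> diamond_edges (Suc m)" for x y
    using that by auto
  have no_loop: "(x, x) \<notin> diamond_edges m" for x using Suc.IH by blast
  have level: "dlevel x \<le> m" "dlevel y \<le> m" if "(x, y) \<in> diamond_edges m" for x y
    using dlevel_edge[OF that] by auto
  have mid_level: "dlevel (Mid x y i) = Suc m" if "(x, y) \<in> diamond_edges m" for x y i
    using dlevel_edge[OF that] by simp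
  show ?case
  proof
    assume vu: "(v, u) \<in> diamond_edges (Suc m)"
    from edgeD[OF Suc.prems] edgeD[OF vu] show False
      by (metis dvertex.inject level mid_level no_loop not_less_eq_eq order_refl)
  qed
qed

lemma diamond_edges_verts: "diamond_edges m \<subseteq> diamond_verts m \<times> diamond_verts m"
  by (induction m) fastforce+

lemma connected_diamond: "connected_graph (diamond_verts m) (diamond_edges m)"
proof -
  define R where "R m = diamond_edges m \<union> (diamond_edges m)\<inverse>" for m
  have symR: "sym ((R m)\<^sup>*)" for m unfolding R_def by (intro sym_rtrancl sym_Un_converse)
  have "(Bot, v) \<in> (R m)\<^sup>*" if "v \<in> diamond_verts m" for v
    using that
  proof (induction m arbitrary: v)
    case 0
    then show ?case by (auto simp: R_def)
  next
    case (Suc m)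
    have mid: "(u, Mid u w i) \<in> R (Suc m)" "(Mid u w i, w) \<in> R (Suc m)"
      if "(u, w) \<in> diamond_edges m" for u w i
      using that by (auto simp: R_def)
    have "(u, w) \<in> (R (Suc m))\<^sup>*" if "(u, w) \<in> diamond_edges m" for u w
      using mid[OF that] by (meson r_into_rtrancl rtrancl_trans)
    then have "R m \<subseteq> (R (Suc m))\<^sup>*"
      using symD[OF symR[of "Suc m"]] by (auto simp: R_def)
    then have mono: "(R m)\<^sup>* \<subseteq> (R (Suc m))\<^sup>*"
      using rtrancl_subset_rtrancl by blast
    consider "v \<in> diamond_verts m" | u w i where "v = Mid u w i" "(u, w) \<in> diamond_edges m"
      using Suc.prems by auto
    then show ?case
    proof cases
      case 1
      then show ?thesis using Suc.IH mono by blast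
    next
      case 2
      then have "(Bot, u) \<in> (R (Suc m))\<^sup>*"
        using Suc.IH mono diamond_edges_verts by blast
      with mid(1)[OF 2(2)] 2(1) show ?thesis by (auto intro: rtrancl_into_rtrancl)
    qed
  qed
  with symR show ?thesis unfolding connected_graph_def R_def
    by (blast dest: symD intro: rtrancl_trans)
qed

lemmas mspace_diamond = mspace_graph_metric[OF connected_diamond, folded diamond_def]
lemmas mdist_diamond = mdist_graph_metric[OF connected_diamond, folded diamond_def]

text \<open>
  The sequence of target spaces is indexed by \<open>m \<ge> 1\<close>.  The infimum is taken in \<^typ>\<open>ereal\<close>, so
  that it is \<open>\<infinity>\<close> if no embedding with the required property exists.
\<close>

definition distortion :: "'a metric \<Rightarrow> (nat \<Rightarrow> 'b metric) \<Rightarrow> ereal" where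
  "distortion M R = Inf (ereal ` {C. C \<ge> 1 \<and>
     (\<exists>m\<ge>1. \<exists>f \<in> mspace M \<rightarrow> mspace (R m). \<exists>r>0. \<forall>u\<in>mspace M. \<forall>v\<in>mspace M.
        r * mdist M u v \<le> mdist (R m) (f u) (f v) \<and>
        mdist (R m) (f u) (f v) \<le> r * C * mdist M u v)})"

end

theory Submission
  imports Defs
begin

text \<open>
  The upper bound comes from mapping all tree vertices to distinct midpoints of the first diamond.

  For the lower bound, let \<open>f\<close> embed the tree with distortion \<open>C\<close> and Lipschitz constant \<open>r C\<close>,
  and let \<open>D = 2\<^sup>m\<^sup>-\<^sup>k\<close> be the distance in the \<open>m\<close>-th diamond between neighbours of the \<open>k\<close>-th one.
  The refinement of an edge \<open>uv\<close> of the \<open>k\<close>-th diamond has diameter at most \<open>2D\<close> and can only be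
  left through \<open>u\<close> and \<open>v\<close>.  If a tree vertex has more than \<open>2D / r\<close> generations below it, all
  long paths going down from it leave the refinement, and the points mapped near \<open>u\<close> (or near \<open>v\<close>)
  are within \<open>2C\<close> of each other.  Since the tree branches, this forces the vertex itself to be
  mapped within \<open>O(r C\<^sup>2)\<close> of the \<open>k\<close>-th diamond.  For \<open>D\<close> a large multiple of \<open>r C\<^sup>2\<close>, a path
  in the tree thus cannot move from one vertex of the \<open>k\<close>-th diamond to another, so its length is
  \<open>O(C\<^sup>2)\<close>, and hence so is \<open>n\<close>.
\<close>

section \<open>Test functions on graphs, and distances in the binary tree\<close>

lemma walk_lipschitz:
  fixes h :: "'a \<Rightarrow> real"
  assumes edge: "\<And>a b. (a, b) \<in> E \<Longrightarrow> \<bar>h a - h b\<bar> \<le> \<delta>"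
    and walk: "(u, v) \<in> (E \<union> E\<inverse>) ^^ k"
  shows "\<bar>h u - h v\<bar> \<le> \<delta> * real k"
  using walk
proof (induction k arbitrary: v)
  case (Suc k)
  then obtain w where w: "(u, w) \<in> (E \<union> E\<inverse>) ^^ k" "(w, v) \<in> E \<union> E\<inverse>" by auto
  have "\<bar>h w - h v\<bar> \<le> \<delta>" using w(2) edge[of w v] edge[of v w] by (auto simp: abs_minus_commute)
  with Suc.IH[OF w(1)] show ?case by (simp add: algebra_simps)
qed simp

text \<open>Lower bounds on distances in trees and diamonds are certified through this lemma, by a
  test function \<open>h\<close> with small increments along edges.\<close>

lemma graph_dist_lipschitz:
  fixes h :: "'a \<Rightarrow> real"
  assumes "\<And>a b. (a, b) \<in> E \<Longrightarrow> \<bar>h a - h b\<bar> \<le> \<delta>"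
    and "connected_graph V E" "u \<in> V" "v \<in> V"
  shows "\<bar>h u - h v\<bar> \<le> \<delta> * real (graph_dist E u v)"
  using walk_lipschitz[OF assms(1) graph_dist_walk[of u v E]] assms(2-4)
  by (auto simp: connected_graph_def)

lemma tree_walk_down:
  "length xs + length ys \<le> n \<Longrightarrow> (xs, xs @ ys) \<in> (tree_edges n \<union> (tree_edges n)\<inverse>) ^^ length ys"
proof (induction ys rule: rev_induct)
  case (snoc b ys)
  then have "(xs, xs @ ys) \<in> (tree_edges n \<union> (tree_edges n)\<inverse>) ^^ length ys" by simp
  moreover have "(xs @ ys, xs @ ys @ [b]) \<in> tree_edges n \<union> (tree_edges n)\<inverse>"
    using snoc.prems by (auto simp: tree_edges_def)
  ultimately show ?case by auto
qed simp

lemma tree_dist_down: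
  "length xs + length ys \<le> n \<Longrightarrow> graph_dist (tree_edges n) xs (xs @ ys) \<le> length ys"
  by (rule graph_dist_le[OF tree_walk_down])

lemma tree_dist_ge_length_diff:
  assumes "length xs \<le> n" "length ys \<le> n"
  shows "\<bar>real (length xs) - real (length ys)\<bar> \<le> real (graph_dist (tree_edges n) xs ys)"
proof -
  have "\<bar>real (length xs) - real (length ys)\<bar> \<le> 1 * real (graph_dist (tree_edges n) xs ys)"
    by (rule graph_dist_lipschitz[OF _ connected_tree])
      (use assms in \<open>auto simp: tree_edges_def tree_verts_def\<close>)
  then show ?thesis by simp
qed

text \<open>A walk from \<open>y\<close> to \<open>z\<close> must leave the subtree below
  \<open>p\<close> through the edge above \<open>p\<close>, which accounts for the
  \<open>+ 1\<close>. The test function is the depth counted from the parent of \<open>p\<close>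
  inside that subtree and 0 outside; it rises from 0 to 1 on that edge.\<close>

lemma tree_dist_separated:
  assumes y: "length y \<le> n" "take (length p) y = p" and z: "length z \<le> n" "take (length p) z \<noteq> p"
    and p: "p \<noteq> []"
  shows "real (length y) - real (length p) + 1 \<le> real (graph_dist (tree_edges n) y z)"
proof -
  define h where "h = (\<lambda>w. if take (length p) w = p then real (length w) - real (length p) + 1 else 0)"
  have "\<bar>h a - h b\<bar> \<le> 1" if ab: "(a, b) \<in> tree_edges n" for a b
  proof -
    obtain c where c: "b = a @ [c]" using ab by (auto simp: tree_edges_def)
    show ?thesis
    proof (cases "length p \<le> length a")
      case False
      then have "take (length p) a \<noteq> p" by (metis length_take min.absorb_iff2 nat_le_linear)
      moreover have "length b = length p" if "take (length p) b = p"
        using that False c by (metis Suc_leI antisym length_append_singleton length_take min.absorb_iff1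
            min.cobounded1 not_le)
      ultimately show ?thesis by (auto simp: h_def)
    qed (auto simp: h_def c)
  qed
  then have "\<bar>h y - h z\<bar> \<le> 1 * real (graph_dist (tree_edges n) y z)"
    by (rule graph_dist_lipschitz[OF _ connected_tree]) (use y z in \<open>auto simp: tree_verts_def\<close>)
  then show ?thesis using assms by (auto simp: h_def tree_verts_def)
qed

lemma tree_dist_le_diam:
  assumes "length xs \<le> n" "length ys \<le> n"
  shows "graph_dist (tree_edges n) xs ys \<le> 2 * n"
proof -
  interpret T: Metric_space "tree_verts n" "\<lambda>u v. real (graph_dist (tree_edges n) u v)"
    by (rule Metric_space_graph_dist[OF connected_tree])
  show ?thesis
    using T.triangle[of xs "[]" ys] T.commute[of xs "[]"] assms
      tree_dist_down[of "[]" xs n] tree_dist_down[of "[]" ys n]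
    by (auto simp: tree_verts_def)
qed

section \<open>Levels and distances in diamonds\<close>

lemma diamond_verts_mono: "l \<le> m \<Longrightarrow> diamond_verts l \<subseteq> diamond_verts m"
  by (rule lift_Suc_mono_le[of diamond_verts]) auto

text \<open>An edge determines the diamond it belongs to by \<open>dlevel_edge\<close>. This permits
  structural induction on a vertex in place of induction on \<open>m\<close>.\<close>

lemma Mid_in_diamond_verts:
  assumes "Mid u v i \<in> diamond_verts m"
  shows "(u, v) \<in> diamond_edges (max (dlevel u) (dlevel v))"
    and "u \<in> diamond_verts m" and "v \<in> diamond_verts m"
proof -
  have "\<exists>l<m. (u, v) \<in> diamond_edges l"
    using assms by (induction m) (auto intro: less_SucI)
  then obtain l where l: "l < m" "(u, v) \<in> diamond_edges l" by blast
  show "(u, v) \<in> diamond_edges (max (dlevel u) (dlevel v))" using dlevel_edge[OF l(2)] l(2) by simp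
  show "u \<in> diamond_verts m" "v \<in> diamond_verts m"
    using diamond_edges_verts[of l] l diamond_verts_mono[of l m] by auto
qed

lemma diamond_walk_edge:
  "(u, v) \<in> diamond_edges l \<Longrightarrow>
    (u, v) \<in> (diamond_edges (l + j) \<union> (diamond_edges (l + j))\<inverse>) ^^ (2 ^ j)"
proof (induction j arbitrary: l u v)
  case (Suc j)
  have "(u, Mid u v 0) \<in> diamond_edges (Suc l)" "(Mid u v 0, v) \<in> diamond_edges (Suc l)"
    using Suc.prems by auto
  from Suc.IH[OF this(1)] Suc.IH[OF this(2)] show ?case
    by (auto simp: relpow_add mult_2)
qed simp

lemma diamond_dist_edge:
  assumes "(u, v) \<in> diamond_edges l" "l \<le> m"
  shows "graph_dist (diamond_edges m) u v \<le> 2 ^ (m - l)"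
  using graph_dist_le[OF diamond_walk_edge[OF assms(1), of "m - l"]] assms(2) by simp

text \<open>Interpolating linearly from the indicator function of the other vertices of level at most
  \<open>k\<close> gives a function whose increments halve at each refinement.\<close>

lemma diamond_coarse_separated:
  assumes "x \<in> diamond_verts m" "y \<in> diamond_verts m" "dlevel x \<le> k" "dlevel y \<le> k"
    and "x \<noteq> y" "k \<le> m"
  shows "2 ^ (m - k) \<le> graph_dist (diamond_edges m) x y"
proof -
  define h :: "dvertex \<Rightarrow> real" where
    "h = rec_dvertex (if x = Bot then 0 else 1) (if x = Top then 0 else 1)
       (\<lambda>u v i hu hv. if dlevel (Mid u v i) \<le> k then (if x = Mid u v i then 0 else 1)
          else (hu + hv) / 2)"
  have coarse: "h w = (if x = w then 0 else 1)" if "dlevel w \<le> k" for w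
    using that by (cases w) (auto simp: h_def)
  have fine: "h (Mid u v i) = (h u + h v) / 2" if "dlevel (Mid u v i) > k" for u v i
    using that by (auto simp: h_def)
  have edge: "\<bar>h a - h b\<bar> \<le> 1 / 2 ^ j" if "(a, b) \<in> diamond_edges (k + j)" for a b j
    using that
  proof (induction j arbitrary: a b)
    case 0
    then have "dlevel a \<le> k" "dlevel b \<le> k" using dlevel_edge[of a b k] by auto
    then show ?case by (simp add: coarse)
  next
    case (Suc j)
    then obtain u v i where uv: "(u, v) \<in> diamond_edges (k + j)"
      and ab: "(a, b) = (u, Mid u v i) \<or> (a, b) = (Mid u v i, v)"
      by auto
    have "h (Mid u v i) = (h u + h v) / 2"
      by (rule fine) (use dlevel_edge[OF uv] in simp)
    then have "h a - h b = (h u - h v) / 2" using ab by (auto simp: field_simps)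
    with Suc.IH[OF uv] show ?case by simp
  qed
  have "\<bar>h x - h y\<bar> \<le> 1 / 2 ^ (m - k) * real (graph_dist (diamond_edges m) x y)"
    by (rule graph_dist_lipschitz[OF _ connected_diamond])
      (use edge[of _ _ "m - k"] assms in auto)
  then have "real (2 ^ (m - k)) \<le> real (graph_dist (diamond_edges m) x y)"
    using assms by (simp add: coarse field_simps)
  then show ?thesis by (simp only: of_nat_le_iff)
qed

section \<open>Refinements of the edges of a coarser diamond\<close>

text \<open>For a vertex \<open>w\<close> of level greater than \<open>k\<close>, the edge of the \<open>k\<close>-th diamond whose
  refinement contains \<open>w\<close>; the values at other vertices are irrelevant.\<close>

primrec anc_edge :: "nat \<Rightarrow> dvertex \<Rightarrow> dvertex \<times> dvertex" where
  "anc_edge k Bot = (Bot, Top)"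
| "anc_edge k Top = (Bot, Top)"
| "anc_edge k (Mid u v i) =
     (if max (dlevel u) (dlevel v) \<le> k then (u, v)
      else if dlevel u > dlevel v then anc_edge k u else anc_edge k v)"

lemma dlevel_anc_edge:
  "dlevel w > k \<Longrightarrow> dlevel (fst (anc_edge k w)) \<le> k \<and> dlevel (snd (anc_edge k w)) \<le> k"
  by (induction w) auto

text \<open>The refinement of an edge can be left only through its ends. By induction on
  \<open>m\<close>: a new midpoint lies in the refinement that contains the edge it subdivides, or
  that edge is itself an edge between coarse vertices.\<close>

lemma anc_edge_adjacent:
  assumes "(x, y) \<in> diamond_edges m \<union> (diamond_edges m)\<inverse>" "dlevel x > k"
  shows "dlevel y > k \<and> anc_edge k y = anc_edge k x \<or>
    y = fst (anc_edge k x) \<or> y = snd (anc_edge k x)"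
proof -
  define P where "P x y \<longleftrightarrow> (dlevel x > k \<longrightarrow> dlevel y > k \<and> anc_edge k y = anc_edge k x \<or>
    y = fst (anc_edge k x) \<or> y = snd (anc_edge k x))" for x y
  have "P x y \<and> P y x" if "(x, y) \<in> diamond_edges m" for x y
    using that
  proof (induction m arbitrary: x y)
    case 0
    then show ?case by (auto simp: P_def)
  next
    case (Suc m)
    then obtain u v i where uv: "(u, v) \<in> diamond_edges m"
      and xy: "(x, y) = (u, Mid u v i) \<or> (x, y) = (Mid u v i, v)"
      by auto
    have "P u v" "P v u" using Suc.IH[OF uv] by auto
    \<comment> \<open>If both levels exceed \<open>k\<close>, neither vertex is an end of the
      other's \<open>anc_edge\<close>, since such ends have level at most \<open>k\<close>.\<close>
    then have "dlevel u \<le> k \<or> dlevel v \<le> k \<or> anc_edge k u = anc_edge k v"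
      using dlevel_anc_edge[of k u] by (auto simp: P_def)
    with \<open>P u v\<close> \<open>P v u\<close>
    have "P (Mid u v i) u \<and> P u (Mid u v i) \<and> P (Mid u v i) v \<and> P v (Mid u v i)"
      by (auto simp: P_def)
    with xy show ?case by auto
  qed
  with assms show ?thesis by (auto simp: P_def)
qed

text \<open>If the last vertex before \<open>q\<close> is still inside the refinement, the last step
  lands on an end; otherwise a shorter walk already leaves it.\<close>

lemma anc_edge_walk_exit:
  assumes "(p, q) \<in> (diamond_edges m \<union> (diamond_edges m)\<inverse>) ^^ t" "dlevel p > k"
    and "\<not> (dlevel q > k \<and> anc_edge k q = anc_edge k p)"
  shows "\<exists>w \<in> {fst (anc_edge k p), snd (anc_edge k p)}. graph_dist (diamond_edges m) p w \<le> t"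
  using assms
proof (induction t arbitrary: q)
  case (Suc t)
  then obtain w where w: "(p, w) \<in> (diamond_edges m \<union> (diamond_edges m)\<inverse>) ^^ t"
    "(w, q) \<in> diamond_edges m \<union> (diamond_edges m)\<inverse>" by auto
  show ?case
  proof (cases "dlevel w > k \<and> anc_edge k w = anc_edge k p")
    case True
    with anc_edge_adjacent[OF w(2), of k] Suc.prems(3)
    have "q \<in> {fst (anc_edge k p), snd (anc_edge k p)}" by auto
    with graph_dist_le[OF Suc.prems(1)] show ?thesis by blast
  next
    case False
    from Suc.IH[OF w(1) Suc.prems(2) this] show ?thesis by fastforce
  qed
qed auto

lemma anc_edge_exit:
  assumes "p \<in> diamond_verts m" "q \<in> diamond_verts m" "dlevel p > k"
    and "\<not> (dlevel q > k \<and> anc_edge k q = anc_edge k p)"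
  shows "\<exists>w \<in> {fst (anc_edge k p), snd (anc_edge k p)}.
    graph_dist (diamond_edges m) p w \<le> graph_dist (diamond_edges m) p q"
proof (rule anc_edge_walk_exit[OF _ assms(3,4)])
  show "(p, q) \<in> (diamond_edges m \<union> (diamond_edges m)\<inverse>) ^^ graph_dist (diamond_edges m) p q"
    using connected_diamond[of m] assms by (auto simp: connected_graph_def intro: graph_dist_walk)
qed

lemma anc_edge_ends:
  assumes "w \<in> diamond_verts m" "dlevel w > k"
  shows "fst (anc_edge k w) \<in> diamond_verts m \<and> dlevel (fst (anc_edge k w)) \<le> k \<and>
    snd (anc_edge k w) \<in> diamond_verts m \<and> dlevel (snd (anc_edge k w)) \<le> k"
  using assms
proof (induction w)
  case (Mid u v i)
  from Mid.IH Mid_in_diamond_verts[OF Mid.prems(1)] show ?case by auto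
qed auto

text \<open>Passing from a midpoint to its parent of higher level costs at most
  \<open>2 ^ (m - dlevel w)\<close>, and these costs form a geometric sum. The extra summand on the
  left is what makes the induction close.\<close>

lemma anc_edge_dist:
  assumes "w \<in> diamond_verts m" "dlevel w > k"
  shows "graph_dist (diamond_edges m) w (fst (anc_edge k w)) + 2 ^ (m - dlevel w) \<le> 2 ^ (m - k)"
  using assms
proof (induction w)
  case (Mid u v i)
  define l where "l = max (dlevel u) (dlevel v)"
  have uv: "(u, v) \<in> diamond_edges l" "u \<in> diamond_verts m" "v \<in> diamond_verts m"
    using Mid_in_diamond_verts[OF Mid.prems(1)] by (auto simp: l_def)
  interpret D: Metric_space "diamond_verts m" "\<lambda>u v. real (graph_dist (diamond_edges m) u v)"
    by (rule Metric_space_graph_dist[OF connected_diamond])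
  have lm: "Suc l \<le> m" using dlevel_vert[OF Mid.prems(1)] by (simp add: l_def)
  have pow: "2 ^ (m - l) = 2 * (2::nat) ^ (m - Suc l)"
    using lm by (metis Suc_diff_Suc Suc_le_lessD power_Suc)
  have "(u, Mid u v i) \<in> diamond_edges (Suc l)" "(Mid u v i, v) \<in> diamond_edges (Suc l)"
    using uv(1) by auto
  from this[THEN diamond_dist_edge[OF _ lm]]
  have near: "graph_dist (diamond_edges m) (Mid u v i) c \<le> 2 ^ (m - Suc l)" if "c \<in> {u, v}" for c
    using that D.commute[of "Mid u v i" u] by auto
  show ?case
  proof (cases "l \<le> k")
    case True
    then have "k = l" using Mid.prems(2) by (auto simp: l_def)
    with near[of u] pow show ?thesis by (simp add: l_def)
  next
    case False
    define c where "c = (if dlevel u > dlevel v then u else v)"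
    have c: "c \<in> {u, v}" "dlevel c = l" "anc_edge k (Mid u v i) = anc_edge k c" "c \<in> diamond_verts m"
      using False uv by (auto simp: c_def l_def)
    have "graph_dist (diamond_edges m) c (fst (anc_edge k c)) + 2 ^ (m - l) \<le> 2 ^ (m - k)"
      using Mid.IH c uv False by (auto split: if_splits)
    moreover have "graph_dist (diamond_edges m) (Mid u v i) (fst (anc_edge k c)) \<le>
      graph_dist (diamond_edges m) (Mid u v i) c + graph_dist (diamond_edges m) c (fst (anc_edge k c))"
      using D.triangle[OF Mid.prems(1) c(4), of "fst (anc_edge k c)"] anc_edge_ends[OF c(4), of k] c(2) False
      by linarith
    ultimately show ?thesis using near[OF c(1)] pow c(3) by (simp add: l_def)
  qed
qed auto

lemma diamond_dist_same_anc_edge: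
  assumes "p \<in> diamond_verts m" "q \<in> diamond_verts m" "dlevel p > k" "dlevel q > k"
    and "anc_edge k p = anc_edge k q"
  shows "graph_dist (diamond_edges m) p q \<le> 2 * 2 ^ (m - k)"
proof -
  interpret D: Metric_space "diamond_verts m" "\<lambda>u v. real (graph_dist (diamond_edges m) u v)"
    by (rule Metric_space_graph_dist[OF connected_diamond])
  let ?a = "fst (anc_edge k p)"
  have "graph_dist (diamond_edges m) p q \<le>
    graph_dist (diamond_edges m) p ?a + graph_dist (diamond_edges m) q ?a"
    using D.triangle[of p ?a q] D.commute[of ?a q] anc_edge_ends[OF assms(1,3)] assms by auto
  then show ?thesis using anc_edge_dist[OF assms(1,3)] anc_edge_dist[OF assms(2,4)] assms(5) by simp
qed

text \<open>Every vertex is within \<open>2 ^ m\<close> of \<open>Bot\<close> or \<open>Top\<close>,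
  and so are these two of each other. The bound serves the case where the whole diamond is smaller
  than the scale required in \<open>depth_le\<close>.\<close>

lemma diamond_dist_le_diam:
  assumes "p \<in> diamond_verts m" "q \<in> diamond_verts m"
  shows "graph_dist (diamond_edges m) p q \<le> 3 * 2 ^ m"
proof -
  interpret D: Metric_space "diamond_verts m" "\<lambda>u v. real (graph_dist (diamond_edges m) u v)"
    by (rule Metric_space_graph_dist[OF connected_diamond])
  have near: "\<exists>a \<in> {Bot, Top}. graph_dist (diamond_edges m) w a \<le> 2 ^ m" if "w \<in> diamond_verts m" for w
  proof (cases "dlevel w = 0")
    case True
    then have "w \<in> {Bot, Top}" by (cases w) auto
    then show ?thesis using D.zero[OF that that] by (intro bexI[of _ w]) auto
  next
    case False
    then have "dlevel (fst (anc_edge 0 w)) \<le> 0" using anc_edge_ends[OF that, of 0] by simp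
    then have "fst (anc_edge 0 w) \<in> {Bot, Top}" by (cases "fst (anc_edge 0 w)") auto
    then show ?thesis using anc_edge_dist[OF that, of 0] False by force
  qed
  obtain a b where ab: "a \<in> {Bot, Top}" "graph_dist (diamond_edges m) p a \<le> 2 ^ m"
    "b \<in> {Bot, Top}" "graph_dist (diamond_edges m) q b \<le> 2 ^ m"
    using near assms by metis
  have V: "a \<in> diamond_verts m" "b \<in> diamond_verts m" "Bot \<in> diamond_verts m" "Top \<in> diamond_verts m"
    using diamond_verts_mono[of 0 m] ab by auto
  have "graph_dist (diamond_edges m) Bot Top \<le> 2 ^ m"
    using diamond_dist_edge[of Bot Top 0 m] by simp
  then have "graph_dist (diamond_edges m) a b \<le> 2 ^ m"
    using ab(1,3) D.commute[of Bot Top] D.zero[OF V(1,2)] by (cases "a = b") auto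
  moreover have "real (graph_dist (diamond_edges m) p q) \<le> real (graph_dist (diamond_edges m) p a)
      + real (graph_dist (diamond_edges m) a b) + real (graph_dist (diamond_edges m) q b)"
    using D.triangle[of p a q] D.triangle[of a b q] D.commute[of b q] ab V assms by auto
  ultimately show ?thesis using ab by linarith
qed

section \<open>The depth of a tree embedded with distortion \<open>C\<close>\<close>

locale tree_in_diamond =
  fixes n m :: nat and f :: "bool list \<Rightarrow> dvertex" and r C :: real
  assumes n: "n \<ge> 1" and r: "r > 0" and C: "C \<ge> 1"
    and f: "length x \<le> n \<Longrightarrow> f x \<in> diamond_verts m"
    and lower: "length x \<le> n \<Longrightarrow> length y \<le> n \<Longrightarrow>
      r * real (graph_dist (tree_edges n) x y) \<le> real (graph_dist (diamond_edges m) (f x) (f y))"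
    and upper: "length x \<le> n \<Longrightarrow> length y \<le> n \<Longrightarrow>
      real (graph_dist (diamond_edges m) (f x) (f y)) \<le> r * C * real (graph_dist (tree_edges n) x y)"
begin

abbreviation dT where "dT x y \<equiv> real (graph_dist (tree_edges n) x y)"
abbreviation dD where "dD x y \<equiv> real (graph_dist (diamond_edges m) x y)"

sublocale D: Metric_space "diamond_verts m" dD
  by (rule Metric_space_graph_dist[OF connected_diamond])

lemma lower_length:
  assumes "length x \<le> n" "length y \<le> n"
  shows "r * (real (length y) - real (length x)) \<le> dD (f x) (f y)"
proof -
  have "real (length y) - real (length x) \<le> dT x y"
    using tree_dist_ge_length_diff[OF assms] by linarith
  then show ?thesis using lower[OF assms] r
    by (meson dual_order.trans less_imp_le mult_left_mono)
qed

lemma upper_down: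
  assumes "length x + length y \<le> n"
  shows "dD (f x) (f (x @ y)) \<le> r * C * real (length y)"
proof -
  have "dT x (x @ y) \<le> real (length y)" using tree_dist_down[OF assms] by simp
  then have "r * C * dT x (x @ y) \<le> r * C * real (length y)"
    using r C by (intro mult_left_mono) auto
  then show ?thesis using upper[of x "x @ y"] assms by simp
qed

text \<open>Distances in the diamond are integers, so the images of two adjacent tree vertices,
  being distinct, are at distance at least 1.\<close>

lemma rC_ge_1: "r * C \<ge> 1"
proof -
  have "0 < dD (f []) (f [False])"
    using lower_length[of "[]" "[False]"] n r by simp
  then have "1 \<le> dD (f []) (f [False])" by simp
  also have "\<dots> \<le> r * C" using upper_down[of "[]" "[False]"] n by simp
  finally show ?thesis .
qed

text \<open>A downward path of length \<open>b\<close> is too long to stay in the refinement of one edge.\<close>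

lemma path_exit:
  assumes long: "r * real b > 2 * 2 ^ (m - k)" and x: "length x + b \<le> n" and p: "length p = b"
    and fx: "dlevel (f x) > k"
  shows "\<exists>i\<le>b. \<exists>w \<in> {fst (anc_edge k (f x)), snd (anc_edge k (f x))}. dD (f (x @ take i p)) w \<le> r * C"
proof -
  define Q where "Q i \<longleftrightarrow> dlevel (f (x @ take i p)) > k \<and> anc_edge k (f (x @ take i p)) = anc_edge k (f x)" for i
  have "\<not> Q b"
  proof
    assume "Q b"
    then have "graph_dist (diamond_edges m) (f x) (f (x @ p)) \<le> 2 * 2 ^ (m - k)"
      using fx x p by (intro diamond_dist_same_anc_edge) (auto simp: Q_def f)
    then have "dD (f x) (f (x @ p)) \<le> 2 * 2 ^ (m - k)"
      by (metis of_nat_le_iff of_nat_mult of_nat_numeral of_nat_power)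
    with lower_length[of x "x @ p"] long x p show False by simp
  qed
  moreover have "Q 0" using fx by (simp add: Q_def)
  \<comment> \<open>Some step of the path leaves the refinement. Its image has length at most
    \<open>r * C\<close>, and by \<open>anc_edge_exit\<close> some end is no farther away than the
    image of the next vertex.\<close>
  ultimately obtain i where i: "i < b" "Q i" "\<not> Q (Suc i)"
    by (metis dec_induct le0 nat_less_le)
  have split: "x @ take (Suc i) p = (x @ take i p) @ [p ! i]"
    using i p by (simp add: take_Suc_conv_app_nth)
  have "dD (f (x @ take i p)) (f (x @ take (Suc i) p)) \<le> r * C"
    using upper_down[of "x @ take i p" "[p ! i]"] i p x split by simp
  moreover have "\<exists>w \<in> {fst (anc_edge k (f (x @ take i p))), snd (anc_edge k (f (x @ take i p)))}.
      graph_dist (diamond_edges m) (f (x @ take i p)) w \<le>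
      graph_dist (diamond_edges m) (f (x @ take i p)) (f (x @ take (Suc i) p))"
    using i x p by (intro anc_edge_exit) (auto simp: Q_def intro!: f)
  ultimately show ?thesis using i by (intro exI[of _ i]) (force simp: Q_def)
qed

text \<open>Three downward paths leave through the two ends of an edge, so two of them leave through the
  same end \<open>w\<close>.  Their exit points have images close to each other, hence lie close to \<open>x\<close>.\<close>

lemma near_coarse_vertex:
  assumes long: "r * real b > 2 * 2 ^ (m - k)" and x: "length x + b \<le> n" and b: "b \<ge> 2"
  shows "\<exists>w \<in> diamond_verts m. dlevel w \<le> k \<and> dD (f x) w \<le> 4 * (r * C) * C"
proof (cases "dlevel (f x) > k")
  case False
  moreover have "f x \<in> diamond_verts m" using x by (intro f) simp
  ultimately show ?thesis using r C by (intro bexI[of _ "f x"]) auto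
next
  case True
  define ends where "ends = {fst (anc_edge k (f x)), snd (anc_edge k (f x))}"
  have ends: "w \<in> diamond_verts m" "dlevel w \<le> k" if "w \<in> ends" for w
    using that anc_edge_ends[OF _ True] f[of x] x by (auto simp: ends_def)
  \<comment> \<open>Words of length 2 supply three different beginnings; the padding with
    \<open>False\<close> extends them to length \<open>b\<close>.\<close>
  have exit: "\<exists>i\<le>b. \<exists>w\<in>ends. dD (f (x @ take i (p @ replicate (b - 2) False))) w \<le> r * C"
    if "length p = 2" for p
    unfolding ends_def by (rule path_exit[OF long x _ True]) (use that b in simp)
  have close: "dD (f x) w \<le> 4 * (r * C) * C"
    if p: "length p = 2" "length q = 2" "p \<noteq> q" and i: "i \<le> b" "j \<le> b" and w: "w \<in> ends"
      and i': "dD (f (x @ take i (p @ replicate (b - 2) False))) w \<le> r * C"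
      and j': "dD (f (x @ take j (q @ replicate (b - 2) False))) w \<le> r * C" for p q i j w
  proof -
    define y where "y = take i (p @ replicate (b - 2) False)"
    define z where "z = take j (q @ replicate (b - 2) False)"
    have len: "length (x @ y) \<le> n" "length (x @ z) \<le> n" using x i p b by (auto simp: y_def z_def)
    have "dD (f (x @ y)) (f (x @ z)) \<le> 2 * (r * C)"
      using D.triangle[of "f (x @ y)" w "f (x @ z)"] D.commute[of w "f (x @ z)"] ends[OF w] f[OF len(1)]
        f[OF len(2)] i' j' unfolding y_def z_def by linarith
    with lower[OF len] have "r * dT (x @ y) (x @ z) \<le> r * (2 * C)" by simp
    then have dyz: "dT (x @ y) (x @ z) \<le> 2 * C" using r by simp
    \<comment> \<open>For \<open>i < 2\<close> the word \<open>y\<close> is short anyway. Otherwise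
      \<open>y\<close> starts with \<open>p\<close> and \<open>z\<close> does not, so
      \<open>tree_dist_separated\<close> bounds \<open>length y - 1\<close> by the distance, which
      is at most \<open>2 * C\<close>.\<close>
    have "real (length y) \<le> 2 * C + 1"
    proof (cases "i < 2")
      case True
      then show ?thesis using C by (simp add: y_def)
    next
      case False
      have "take 2 y = p" using False p b by (simp add: y_def min_def take_all)
      moreover have "take 2 z \<noteq> p"
        using p by (cases "2 \<le> j") (auto simp: z_def min_def dest: arg_cong[of _ _ length])
      ultimately have "real (length (x @ y)) - real (length (x @ p)) + 1 \<le> dT (x @ y) (x @ z)"
        using len p by (intro tree_dist_separated) auto
      then show ?thesis using dyz p by simp
    qed
    then have "r * C * real (length y) \<le> r * C * (2 * C + 1)" using r C by (intro mult_left_mono) auto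
    then have "dD (f x) (f (x @ y)) \<le> r * C * (2 * C + 1)"
      using upper_down[of x y] len by simp
    then have "dD (f x) w \<le> r * C * (2 * C + 1) + r * C"
      using D.triangle[of "f x" "f (x @ y)" w] ends[OF w] f[OF len(1)] f[of x] x i' unfolding y_def
      by linarith
    also have "\<dots> \<le> 4 * (r * C) * C"
      using mult_left_mono[OF C, of "r * C"] r C by (simp add: algebra_simps)
    finally show ?thesis .
  qed
  obtain i1 w1 where 1: "i1 \<le> b" "w1 \<in> ends"
    "dD (f (x @ take i1 ([False, False] @ replicate (b - 2) False))) w1 \<le> r * C"
    using exit[of "[False, False]"] by auto
  obtain i2 w2 where 2: "i2 \<le> b" "w2 \<in> ends"
    "dD (f (x @ take i2 ([False, True] @ replicate (b - 2) False))) w2 \<le> r * C"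
    using exit[of "[False, True]"] by auto
  obtain i3 w3 where 3: "i3 \<le> b" "w3 \<in> ends"
    "dD (f (x @ take i3 ([True, False] @ replicate (b - 2) False))) w3 \<le> r * C"
    using exit[of "[True, False]"] by auto
  have "w1 = w2 \<or> w1 = w3 \<or> w2 = w3" using 1 2 3 by (auto simp: ends_def)
  moreover have "dD (f x) w1 \<le> 4 * (r * C) * C" if "w1 = w2"
    by (rule close[of "[False, False]" "[False, True]", OF _ _ _ 1(1) 2(1) 1(2,3) 2(3)[folded that]]) simp_all
  moreover have "dD (f x) w1 \<le> 4 * (r * C) * C" if "w1 = w3"
    by (rule close[of "[False, False]" "[True, False]", OF _ _ _ 1(1) 3(1) 1(2,3) 3(3)[folded that]]) simp_all
  moreover have "dD (f x) w2 \<le> 4 * (r * C) * C" if "w2 = w3"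
    by (rule close[of "[False, True]" "[True, False]", OF _ _ _ 2(1) 3(1) 2(2,3) 3(3)[folded that]]) simp_all
  ultimately have "\<exists>w\<in>ends. dD (f x) w \<le> 4 * (r * C) * C" using 1(2) 2(2) by blast
  with ends show ?thesis by blast
qed

lemma depth_le: "real n \<le> 49 * C\<^sup>2"
proof -
  define K where "K = r * C * C"
  have "K \<ge> r * C" using mult_left_mono[OF C, of "r * C"] r C by (simp add: K_def)
  then have K: "K \<ge> 1" "K \<ge> r * C" "K = r * C\<^sup>2"
    using rC_ge_1 by (auto simp: K_def power2_eq_square)
  have C2: "C\<^sup>2 \<ge> 1" using C by simp
  \<comment> \<open>Coarse vertices near consecutive path vertices are within 4K + K + 4K = 9K of
    each other, so \<open>2 ^ j\<close> must exceed \<open>9 * K\<close> to force them to coincide.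
    Minimality keeps \<open>2 ^ j\<close> at most 18K.\<close>
  define j where "j = (LEAST j. 9 * K < 2 ^ j)"
  have "\<exists>j. 9 * K < 2 ^ j" by (rule real_arch_pow) simp
  then have j: "9 * K < 2 ^ j" unfolding j_def by (rule LeastI_ex)
  then have "j \<noteq> 0" using K(1) by (cases j) auto
  then have "\<not> 9 * K < 2 ^ (j - 1)" unfolding j_def by (intro not_less_Least) simp
  then have j': "2 ^ (j - 1) \<le> 9 * K" by simp
  show ?thesis
  proof (cases "j \<le> m")
    \<comment> \<open>No coarser diamond has scale \<open>2 ^ j\<close> here; the diameter alone
      bounds \<open>n\<close>.\<close>
    case False
    have "r * real n \<le> dD (f []) (f (replicate n False))"
      using lower_length[of "[]" "replicate n False"] by simp
    also have "\<dots> \<le> real (3 * 2 ^ m)"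
      using diamond_dist_le_diam[OF f f, of "[]" "replicate n False"] by (simp only: of_nat_le_iff) simp
    also have "\<dots> \<le> 3 * 2 ^ (j - 1)" using False by (simp add: power_increasing)
    also have "\<dots> \<le> r * (27 * C\<^sup>2)" using j' K by simp
    finally show ?thesis using r C2 by simp
  next
    case True
    define k where "k = m - j"
    have kj: "m - k = j" "k \<le> m" using True by (auto simp: k_def)
    have pow: "(2::real) ^ j = 2 * 2 ^ (j - 1)" using \<open>j \<noteq> 0\<close> by (cases j) auto
    \<comment> \<open>The summand 2 gives both the strict inequality in \<open>long\<close> and
      \<open>b \<ge> 2\<close>.\<close>
    define b where "b = nat \<lfloor>2 * 2 ^ j / r\<rfloor> + 2"
    have "2 * 2 ^ j / r \<ge> 0" using r by simp
    then have b: "real b > 2 * 2 ^ j / r" "real b \<le> 2 * 2 ^ j / r + 2" unfolding b_def by linarith+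
    have long: "r * real b > 2 * 2 ^ (m - k)" using b(1) r kj by (simp add: field_simps)
    have "2 * 2 ^ j / r \<le> 36 * C\<^sup>2"
      using j' pow K(3) r by (simp add: field_simps)
    then have b': "real b \<le> 38 * C\<^sup>2" using b(2) C2 by linarith
    show ?thesis
    proof (cases "n \<le> b")
      case True
      then show ?thesis using b' C2 by linarith
    next
      case False
      \<comment> \<open>Only the all-\<open>False\<close> branch is followed, down to depth
        \<open>n - b\<close>, so that \<open>b\<close> generations remain below each of its
        vertices.\<close>
      define x where "x i = replicate i False" for i
      have near: "\<exists>w. w \<in> diamond_verts m \<and> dlevel w \<le> k \<and> dD (f (x i)) w \<le> 4 * K" if "i \<le> n - b" for i
      proof -
        have "length (x i) + b \<le> n" "b \<ge> 2" using that False by (auto simp: x_def b_def)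
        from near_coarse_vertex[OF long this] show ?thesis by (auto simp: K_def mult.assoc)
      qed
      obtain w where w: "\<And>i. i \<le> n - b \<Longrightarrow> w i \<in> diamond_verts m \<and> dlevel (w i) \<le> k \<and> dD (f (x i)) (w i) \<le> 4 * K"
        using near by metis
      have fx: "f (x i) \<in> diamond_verts m" if "i \<le> n - b" for i using that by (intro f) (simp add: x_def)
      have const: "w i = w 0" if "i \<le> n - b" for i
        using that
      proof (induction i)
        case (Suc i)
        have "Suc i \<le> n" using Suc.prems by linarith
        then have "dD (f (x i)) (f (x (Suc i))) \<le> K"
          using upper_down[of "x i" "[False]"] K(2) by (simp add: x_def replicate_append_same)
        then have "dD (w i) (w (Suc i)) \<le> 9 * K"
          using D.triangle[of "w i" "f (x i)" "w (Suc i)"] D.commute[of "w i" "f (x i)"]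
            D.triangle[of "f (x i)" "f (x (Suc i))" "w (Suc i)"]
            w[of i] w[of "Suc i"] fx[of i] fx[of "Suc i"] Suc.prems by fastforce
        then have "dD (w i) (w (Suc i)) < 2 ^ j" using j by linarith
        then have "graph_dist (diamond_edges m) (w i) (w (Suc i)) < 2 ^ (m - k)"
          using kj(1) by (metis of_nat_less_iff of_nat_numeral of_nat_power)
        then have "w i = w (Suc i)"
          using diamond_coarse_separated[of "w i" m "w (Suc i)" k] w[of i] w[of "Suc i"] Suc.prems kj(2)
          by fastforce
        then show ?case using Suc by simp
      qed simp
      have "r * real (n - b) \<le> dD (f (x 0)) (f (x (n - b)))"
        using lower_length[of "x 0" "x (n - b)"] by (simp add: x_def)
      also have "\<dots> \<le> dD (f (x 0)) (w 0) + dD (f (x (n - b))) (w 0)"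
        using D.triangle[of "f (x 0)" "w 0" "f (x (n - b))"] D.commute[of "w 0"] w[of 0] fx by auto
      also have "\<dots> \<le> r * (8 * C\<^sup>2)" using w[of 0] w[of "n - b"] const[of "n - b"] K(3) by simp
      finally have "real (n - b) \<le> 8 * C\<^sup>2" using r by simp
      \<comment> \<open>The sum 8 + 38 = 46 is rounded up to the square 49, whence the final
        constant 1/7.\<close>
      then show ?thesis using b' False C2 by linarith
    qed
  qed
qed

end

section \<open>Upper bound: an embedding into the first diamond\<close>

text \<open>Gives an infinite equilateral set, which can receive any finite tree
  injectively.\<close>

lemma diamond_1_dist_midpoints:
  assumes "i \<noteq> j"
  shows "graph_dist (diamond_edges 1) (Mid Bot Top i) (Mid Bot Top j) = 2"
proof (rule antisym)
  have "(Mid Bot Top i, Mid Bot Top j) \<in>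
      (diamond_edges 1 \<union> (diamond_edges 1)\<inverse>) ^^ 2"
    by (auto simp: numeral_2_eq_2 intro!: relcompI[of _ Bot])
  then show "graph_dist (diamond_edges 1) (Mid Bot Top i) (Mid Bot Top j) \<le> 2"
    by (rule graph_dist_le)
  define h :: "dvertex \<Rightarrow> real" where
    "h w = (if w = Mid Bot Top i then 0 else if w \<in> {Bot, Top} then 1 else 2)" for w
  have "\<bar>h (Mid Bot Top i) - h (Mid Bot Top j)\<bar> \<le>
      1 * real (graph_dist (diamond_edges 1) (Mid Bot Top i) (Mid Bot Top j))"
    by (rule graph_dist_lipschitz[OF _ connected_diamond]) (auto simp: h_def)
  then show "2 \<le> graph_dist (diamond_edges 1) (Mid Bot Top i) (Mid Bot Top j)"
    using assms by (simp add: h_def)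
qed

lemma distortion_tree_diamond_le:
  assumes n: "n \<ge> 1"
  shows "distortion (binary_tree n) diamond \<le> ereal (2 * real n)"
proof -
  define f :: "bool list \<Rightarrow> dvertex" where "f xs = Mid Bot Top (to_nat xs)" for xs
  interpret T: Metric_space "tree_verts n" "\<lambda>u v. real (graph_dist (tree_edges n) u v)"
    by (rule Metric_space_graph_dist[OF connected_tree])
  interpret D: Metric_space "diamond_verts 1" "\<lambda>u v. real (graph_dist (diamond_edges 1) u v)"
    by (rule Metric_space_graph_dist[OF connected_diamond])
  have f: "f xs \<in> diamond_verts 1" for xs by (simp add: f_def)
  \<comment> \<open>All nonzero image distances are 2, while nonzero tree distances range within 1
    to 2n. The largest dictates \<open>r = 1 / n\<close>, the smallest then the constant
    \<open>2 * n\<close>.\<close>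
  have bounds: "1 / real n * real (graph_dist (tree_edges n) u v)
        \<le> real (graph_dist (diamond_edges 1) (f u) (f v)) \<and>
      real (graph_dist (diamond_edges 1) (f u) (f v))
        \<le> 1 / real n * (2 * real n) * real (graph_dist (tree_edges n) u v)"
    if uv: "u \<in> tree_verts n" "v \<in> tree_verts n" for u v
  proof (cases "u = v")
    case True
    then show ?thesis using T.zero[of u u] D.zero[of "f u" "f u"] uv f by simp
  next
    case False
    then have "graph_dist (diamond_edges 1) (f u) (f v) = 2"
      unfolding f_def by (intro diamond_1_dist_midpoints) simp
    moreover have "graph_dist (tree_edges n) u v \<noteq> 0" using T.zero[OF uv] False by simp
    moreover have "real (graph_dist (tree_edges n) u v) \<le> 2 * real n"
      using tree_dist_le_diam[of u n v] uv by (simp add: tree_verts_def)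
    ultimately show ?thesis using n by (auto simp: field_simps)
  qed
  have "2 * real n \<in> {C. C \<ge> 1 \<and> (\<exists>m\<ge>1. \<exists>f \<in> mspace (binary_tree n) \<rightarrow> mspace (diamond m).
      \<exists>r>0. \<forall>u\<in>mspace (binary_tree n). \<forall>v\<in>mspace (binary_tree n).
        r * mdist (binary_tree n) u v \<le> mdist (diamond m) (f u) (f v) \<and>
        mdist (diamond m) (f u) (f v) \<le> r * C * mdist (binary_tree n) u v)}"
    unfolding mem_Collect_eq mspace_binary_tree mdist_binary_tree mspace_diamond mdist_diamond
    using n f bounds
    by (intro conjI exI[of _ "1::nat"] bexI[of _ f] exI[of _ "1 / real n"] ballI) auto
  then show ?thesis unfolding distortion_def by (intro Inf_lower imageI)
qed

section \<open>Lower bound for the infimum, and both bounds together\<close>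

lemma distortion_tree_diamond_ge:
  assumes n: "n \<ge> 1"
  shows "ereal (1 / 7 * sqrt (real n)) \<le> distortion (binary_tree n) diamond"
  unfolding distortion_def mspace_binary_tree mdist_binary_tree mspace_diamond mdist_diamond
proof (rule Inf_greatest, elim imageE CollectE conjE bexE exE)
  fix x :: ereal and C r :: real and m :: nat and f
  assume x: "x = ereal C" and *: "1 \<le> C" "f \<in> tree_verts n \<rightarrow> diamond_verts m" "0 < r"
    "\<forall>u\<in>tree_verts n. \<forall>v\<in>tree_verts n.
       r * real (graph_dist (tree_edges n) u v) \<le> real (graph_dist (diamond_edges m) (f u) (f v)) \<and>
       real (graph_dist (diamond_edges m) (f u) (f v)) \<le> r * C * real (graph_dist (tree_edges n) u v)"
  then have "tree_in_diamond n m f r C"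
    using n by unfold_locales (auto simp: tree_verts_def)
  then have "real n \<le> (7 * C)\<^sup>2" by (simp add: tree_in_diamond.depth_le power_mult_distrib)
  then have "sqrt (real n) \<le> 7 * C" using *(1) by (intro real_le_lsqrt) auto
  then show "ereal (1 / 7 * sqrt (real n)) \<le> x" by (simp add: x)
qed

theorem theorem2p7:
  shows "\<exists>c::real. c > 0 \<and> (\<forall>n::nat. n \<ge> 1 \<longrightarrow>
    ereal (c * sqrt (real n)) \<le> distortion (binary_tree n) diamond \<and>
    distortion (binary_tree n) diamond \<le> ereal (2 * real n))"
proof (intro exI[of _ "1 / 7"] conjI allI impI)
  fix n :: nat
  assume n: "n \<ge> 1"
  show "ereal (1 / 7 * sqrt (real n)) \<le> distortion (binary_tree n) diamond"
    by (rule distortion_tree_diamond_ge[OF n])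
  show "distortion (binary_tree n) diamond \<le> ereal (2 * real n)"
    by (rule distortion_tree_diamond_le[OF n])
qed simp

end
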